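(* Let $X$ be a space with walls. There exists an injective morphism of spaces with walls $\sigma\colon X\to \mathcal{C}^1(X)$, where $\mathcal{C}^1(X)$ is a connected median graph, and $\sigma(X)$ "spans" $\mathcal{C}^1(X)$, in the sense that no proper subgraph of $\mathcal{C}^1(X)$ containing $\sigma(X)$ is median.
   Context: **Spaces with walls.** Let $X$ be a set. A wall in $X$ is a partition of $X$ into two subsets called halfspaces (the empty set is allowed as one of them). A wall separates two distinct points $x,y\in X$ if $x$ belongs to one of the halfspaces determined by the wall, while $y$ belongs to the other halfspace. $X$ is a space with walls if it is endowed with a collection of walls that contains the trivial wall $\{\emptyset,X\}$ and is such that any two distinct points are separated by a finite, non-zero number of walls of the collection. The halfspaces of $X$ are the halfspaces of the walls in this collection. A morphism of spaces with walls is a map $f\colon X\to X'$ between spaces with walls such that $f^{-1}(A')$ is a halfspace of $X$ for each halfspace $A'$ of $X'$. **Median graphs.** Unless otherwise specified, graphs are assumed to be connected, simplicial (no loops or multiple edges), and equipped with the path metric. The geodesic interval $[x,y]$ determined by vertices $x$ and $y$ is the collection of vertices lying on a shortest path from $x$ to $y$. A graph is median if, for each triple of vertices $x,y,z$, the geodesic intervals $[x,y]$, $[y,z]$, $[z,x]$ have a unique common point. **Median graphs as spaces with walls.** A set $A$ of vertices of a median graph is convex if $[x,y]\subseteq A$ for all $x,y\in A$, and is a halfspace if both $A$ and its complement are convex. The vertex set of a median graph is a space with walls, the walls being all pairs of complementary halfspaces. A map into a median graph is understood as a map into its vertex set.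
   Formalization: The spanning claim is proved for proper subgraphs whose path metric is the restriction of that of the ambient graph; for arbitrary subgraphs it is false, e.g. when X is the vertex set of a 4-cycle, since a subtree containing the image of X is median. *)

theory Defs
  imports "Graph_Theory.Graph_Theory"
begin

section \<open>Spaces with walls\<close>

text \<open>A wall is represented by the set of its (at most) two halfspaces. A collection of walls is a
  set of such sets.\<close>

definition is_wall :: "'a set \<Rightarrow> 'a set set \<Rightarrow> bool" where
  "is_wall X w \<longleftrightarrow> (\<exists>A \<subseteq> X. w = {A, X - A})"

definition separates :: "'a set set \<Rightarrow> 'a \<Rightarrow> 'a \<Rightarrow> bool" where
  "separates w x y \<longleftrightarrow> (\<exists>A\<in>w. \<exists>B\<in>w. A \<noteq> B \<and> x \<in> A \<and> y \<in> B)"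

locale space_with_walls =
  fixes X :: "'a set" and W :: "'a set set set"
  assumes walls: "w \<in> W \<Longrightarrow> is_wall X w"
    and trivial_wall: "{{}, X} \<in> W"
    and finite_separating: "\<lbrakk>x \<in> X; y \<in> X; x \<noteq> y\<rbrakk> \<Longrightarrow> finite {w \<in> W. separates w x y}"
    and ex_separating: "\<lbrakk>x \<in> X; y \<in> X; x \<noteq> y\<rbrakk> \<Longrightarrow> \<exists>w\<in>W. separates w x y"

definition halfspaces :: "'a set set set \<Rightarrow> 'a set set" where
  "halfspaces W = \<Union>W"

locale walls_morphism =
  source: space_with_walls X W + target: space_with_walls X' W'
  for X :: "'a set" and W :: "'a set set set" and X' :: "'b set" and W' :: "'b set set set" +
  fixes f :: "'a \<Rightarrow> 'b"
  assumes maps_to: "x \<in> X \<Longrightarrow> f x \<in> X'"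
    and vimage_halfspace: "A' \<in> halfspaces W' \<Longrightarrow> {x \<in> X. f x \<in> A'} \<in> halfspaces W"


section \<open>Median graphs\<close>

text \<open>A simplicial, possibly infinite, graph is a loop-free symmetric digraph whose arcs are ordered
  pairs of vertices, that is, a \<^locale>\<open>pair_bidirected_digraph\<close>; an edge is a pair of opposite arcs.
  The path metric is only meaningful for connected graphs. A walk of minimal length is necessarily a
  path, so walks may be used in place of paths in the next two definitions.\<close>

definition path_dist :: "'a pair_pre_digraph \<Rightarrow> 'a \<Rightarrow> 'a \<Rightarrow> nat" where
  "path_dist G x y = (LEAST n. \<exists>p. pre_digraph.awalk (with_proj G) x p y \<and> length p = n)"

definition geodesic_interval :: "'a pair_pre_digraph \<Rightarrow> 'a \<Rightarrow> 'a \<Rightarrow> 'a set" where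
  "geodesic_interval G x y =
     {z. \<exists>p. pre_digraph.awalk (with_proj G) x p y \<and> length p = path_dist G x y \<and>
             z \<in> set (pre_digraph.awalk_verts (with_proj G) x p)}"

locale median_graph = pair_bidirected_digraph G for G :: "'a pair_pre_digraph" +
  assumes connected_graph: "Digraph_Component.connected (with_proj G)"
    and median: "\<lbrakk>x \<in> pverts G; y \<in> pverts G; z \<in> pverts G\<rbrakk> \<Longrightarrow>
      \<exists>!m. m \<in> geodesic_interval G x y \<inter> geodesic_interval G y z \<inter> geodesic_interval G z x"

definition graph_convex :: "'a pair_pre_digraph \<Rightarrow> 'a set \<Rightarrow> bool" where
  "graph_convex G A \<longleftrightarrow>
     A \<subseteq> pverts G \<and> (\<forall>x\<in>A. \<forall>y\<in>A. geodesic_interval G x y \<subseteq> A)"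

definition graph_walls :: "'a pair_pre_digraph \<Rightarrow> 'a set set set" where
  "graph_walls G = {{A, pverts G - A} |A. graph_convex G A \<and> graph_convex G (pverts G - A)}"

text \<open>That a subgraph is median is understood for subgraphs whose own path metric is the restriction of
  the ambient one; for a connected subgraph of a median graph, being isometric and median amounts to
  being induced and closed under the ambient medians. Without this proviso the spanning property
  cannot hold. Let \<open>X\<close> be the vertex set of a 4-cycle, with the walls of this median graph, embedded
  by a morphism in a median graph. A finite subtree containing the image of \<open>X\<close> is a median graph for
  its own path metric, so the ambient graph would have to be a tree; but given two walls of a tree,
  some halfspace of one is disjoint from some halfspace of the other, unlike for the two non-trivial
  walls of \<open>X\<close>. Requiring the subgraph merely
  to be induced does not suffice for the cubulation: when \<open>X\<close> is the set of even vertices of the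
  3-cube \<open>{0,1}\<^sup>3\<close> with the restricted walls, the cubulation is the cube, but the 4-cycle
  \<open>100, 101, 111, 110\<close> with the pendant vertices \<open>000\<close> and \<open>011\<close> is an induced subgraph that contains
  \<open>X\<close> and is a median graph for its own path metric.\<close>

definition isometric_subgraph :: "'a pair_pre_digraph \<Rightarrow> 'a pair_pre_digraph \<Rightarrow> bool" where
  "isometric_subgraph H G \<longleftrightarrow> subgraph (with_proj H) (with_proj G) \<and>
     (\<forall>x\<in>pverts H. \<forall>y\<in>pverts H. path_dist H x y = path_dist G x y)"

end

theory Submission
  imports Defs
begin

text \<open>A point of \<open>X\<close> chooses a side of every wall, namely the side that contains it. The median graph
  consists of all consistent choices of sides (any two chosen halfspaces meet) that differ from the
  choice of a point on only finitely many walls; two choices are adjacent if they differ on exactly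
  one wall.

  If two choices \<open>v\<close> and \<open>w\<close> differ, then among the finitely many halfspaces in \<open>v - w\<close> a minimal one
  can be exchanged for its complement without losing consistency (\<open>exists_flip_towards\<close>). Hence the
  graph is connected, its path metric counts the walls on which \<open>v\<close> and \<open>w\<close> differ, and the interval
  from \<open>v\<close> to \<open>w\<close> consists of the choices that contain \<open>v \<inter> w\<close> (\<open>geodesic_interval_cubulation\<close>). The
  three intervals of a triple therefore meet exactly in the wall-by-wall majority vote, which is
  again consistent; so the graph is median.

  A convex set with convex complement that is neither empty nor everything is crossed by some edge,
  along which a single halfspace \<open>A\<close> is flipped; the interval description forces it to be the set of all
  choices containing \<open>A\<close> (\<open>halfspace_cubulation_cases\<close>). Its preimage in \<open>X\<close> is \<open>A\<close> itself, so the
  canonical map is a morphism.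

  An isometric median subgraph containing the image of \<open>X\<close> has a vertex set \<open>N\<close> closed under majority
  votes. Any two halfspaces in a choice \<open>v\<close> have a common point, so a Helly type induction shows that
  every finite part of \<open>v\<close> is contained in a member of \<open>N\<close> (\<open>majority_closed_helly\<close>). Such a
  member may still differ from \<open>v\<close> on other walls; choosing it as close as possible to a fixed member
  of \<open>N\<close> excludes this and gives \<open>v \<in> N\<close> (\<open>majority_closed_eq_cube_verts\<close>). Finally, isometry forces all edges
  to be present.\<close>

context space_with_walls
begin

section \<open>Orientations of the proper halfspaces\<close>

text \<open>For nonempty \<open>X\<close> a consistent choice is forced on the trivial wall, where it selects \<open>X\<close>, so
  leaving this wall out loses no information; it makes the case of empty \<open>X\<close> uniform: no halfspaces remain, and the empty choice is the only
  vertex.\<close>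

definition proper_halfspaces :: "'a set set" where
  "proper_halfspaces = halfspaces W - {{}, X}"

definition orientation :: "'a set set \<Rightarrow> bool" where
  "orientation v \<longleftrightarrow> v \<subseteq> proper_halfspaces \<and>
     (\<forall>A\<in>proper_halfspaces. A \<in> v \<longleftrightarrow> X - A \<notin> v) \<and> (\<forall>A\<in>v. \<forall>B\<in>v. A \<inter> B \<noteq> {})"

definition halfspaces_at :: "'a \<Rightarrow> 'a set set" where
  "halfspaces_at x = {A \<in> proper_halfspaces. x \<in> A}"

text \<open>The finiteness condition is imposed for every point rather than for a chosen base point, so that
  it is canonical and vacuous when \<open>X\<close> is empty.\<close>

definition cube_verts :: "'a set set set" where
  "cube_verts = {v. orientation v \<and> (\<forall>x\<in>X. finite (v - halfspaces_at x))}"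

lemma halfspace_wall: "A \<in> halfspaces W \<Longrightarrow> A \<subseteq> X \<and> {A, X - A} \<in> W"
  unfolding halfspaces_def using walls unfolding is_wall_def
  by (smt (verit) Diff_Diff_Int Diff_subset UnionE empty_iff inf.absorb_iff2 insert_commute insert_iff)

lemma proper_halfspaceD:
  assumes "A \<in> proper_halfspaces"
  shows "A \<subseteq> X" "X - (X - A) = A" "X - A \<in> proper_halfspaces"
proof -
  have A: "A \<subseteq> X" "{A, X - A} \<in> W" "A \<noteq> {}" "A \<noteq> X"
    using assms halfspace_wall unfolding proper_halfspaces_def by auto
  then show "A \<subseteq> X" "X - (X - A) = A" "X - A \<in> proper_halfspaces"
    unfolding proper_halfspaces_def halfspaces_def by auto
qed

lemma trivial_halfspaces: "{} \<in> halfspaces W" "X \<in> halfspaces W"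
  unfolding halfspaces_def using trivial_wall by blast+

lemma orientationD:
  assumes "orientation v" "A \<in> v"
  shows "A \<in> proper_halfspaces" "X - A \<notin> v"
  using assms unfolding orientation_def by auto

lemma orientation_not_memD:
  assumes "orientation v" "A \<in> proper_halfspaces" "A \<notin> v"
  shows "X - A \<in> v"
  using assms unfolding orientation_def by auto

text \<open>Complementation exchanges the halfspaces chosen only by \<open>v\<close> with those chosen only by \<open>w\<close>. Hence
  the number of walls on which the two differ can be read off from either one-sided difference.\<close>

lemma orientation_diff_eq:
  assumes "orientation v" "orientation w"
  shows "w - v = (\<lambda>A. X - A) ` (v - w)"
proof (intro set_eqI iffI)
  fix A assume "A \<in> w - v"
  then have "X - A \<in> v - w" "A = X - (X - A)"
    using assms orientationD orientation_not_memD proper_halfspaceD by auto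
  then show "A \<in> (\<lambda>A. X - A) ` (v - w)" by blast
next
  fix A assume "A \<in> (\<lambda>A. X - A) ` (v - w)"
  then show "A \<in> w - v"
    using assms orientationD orientation_not_memD by blast
qed

lemma orientation_subset_eq:
  assumes "orientation v" "orientation w" "v \<subseteq> w"
  shows "v = w"
  using orientation_diff_eq[OF assms(1,2)] assms(3) by auto

lemma orientation_halfspaces_at: "x \<in> X \<Longrightarrow> orientation (halfspaces_at x)"
  unfolding orientation_def halfspaces_at_def using proper_halfspaceD(3) by blast

text \<open>A halfspace containing \<open>x\<close> but not \<open>y\<close> belongs to a wall separating them, and it is recovered from
  this wall as the side of \<open>x\<close>.\<close>

lemma finite_halfspaces_at_diff:
  assumes "x \<in> X" "y \<in> X"
  shows "finite (halfspaces_at x - halfspaces_at y)"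
proof (cases "x = y")
  case False
  have inj: "inj_on (\<lambda>A. {A, X - A}) (halfspaces_at x - halfspaces_at y)"
    by (rule inj_onI) (auto simp: halfspaces_at_def doubleton_eq_iff)
  have "(\<lambda>A. {A, X - A}) ` (halfspaces_at x - halfspaces_at y) \<subseteq> {w \<in> W. separates w x y}"
    using halfspace_wall assms
    by (fastforce simp: halfspaces_at_def proper_halfspaces_def separates_def)
  then show ?thesis
    using finite_imageD[OF _ inj] finite_subset finite_separating[OF assms False] by blast
qed simp

lemma halfspaces_at_in_cube_verts: "x \<in> X \<Longrightarrow> halfspaces_at x \<in> cube_verts"
  unfolding cube_verts_def using orientation_halfspaces_at finite_halfspaces_at_diff by blast

lemma inj_on_halfspaces_at: "inj_on halfspaces_at X"
proof (rule inj_onI, rule ccontr)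
  fix x y assume xy: "x \<in> X" "y \<in> X" "halfspaces_at x = halfspaces_at y" "x \<noteq> y"
  obtain w where w: "w \<in> W" "separates w x y" using ex_separating xy by blast
  then obtain A where "A \<in> w" "x \<in> A" "y \<notin> A"
    using walls[OF w(1)] unfolding is_wall_def separates_def by auto
  then have "A \<in> halfspaces_at x - halfspaces_at y"
    using w(1) xy(1,2) unfolding halfspaces_at_def proper_halfspaces_def halfspaces_def by blast
  with xy show False by simp
qed

lemma cube_vertsD: "v \<in> cube_verts \<Longrightarrow> orientation v"
  unfolding cube_verts_def by simp

lemma finite_cube_diff:
  assumes "v \<in> cube_verts" "w \<in> cube_verts"
  shows "finite (v - w)"
proof (cases "X = {}")
  case True
  then have "v = {}"
    using assms(1) proper_halfspaceD(1) orientationD(1)[OF cube_vertsD]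
    unfolding proper_halfspaces_def by blast
  then show ?thesis by simp
next
  case False
  then obtain x where x: "x \<in> X" by auto
  have "finite (w - halfspaces_at x)" "finite (v - halfspaces_at x)"
    using assms x unfolding cube_verts_def by auto
  moreover have "halfspaces_at x - w = (\<lambda>A. X - A) ` (w - halfspaces_at x)"
    using orientation_diff_eq cube_vertsD assms(2) orientation_halfspaces_at x by blast
  moreover have "v - w \<subseteq> (v - halfspaces_at x) \<union> (halfspaces_at x - w)" by auto
  ultimately show ?thesis by (metis finite_UnI finite_imageI finite_subset)
qed

lemma cube_vertsI:
  assumes "orientation u" "v \<in> cube_verts" "finite (u - v)"
  shows "u \<in> cube_verts"
proof -
  have "finite (u - halfspaces_at x)" if "x \<in> X" for x
  proof -
    have "u - halfspaces_at x \<subseteq> (u - v) \<union> (v - halfspaces_at x)" by auto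
    moreover have "finite (v - halfspaces_at x)"
      using assms(2) that unfolding cube_verts_def by blast
    ultimately show ?thesis using assms(3) finite_subset by blast
  qed
  then show ?thesis using assms(1) unfolding cube_verts_def by blast
qed

lemma card_cube_diff_commute:
  assumes "v \<in> cube_verts" "w \<in> cube_verts"
  shows "card (w - v) = card (v - w)"
  by (metis assms card_image_le cube_vertsD finite_cube_diff le_antisym orientation_diff_eq)

definition flip :: "'a set \<Rightarrow> 'a set set \<Rightarrow> 'a set set" where
  "flip A v = insert (X - A) (v - {A})"

text \<open>Every distance computation and the description of the halfspaces rest on this lemma. Flipping
  \<open>A\<close> breaks consistency only if some other \<open>B \<in> v\<close> misses \<open>X - A\<close>, that is, \<open>B \<subset> A\<close>. Such a \<open>B\<close> lies
  outside \<open>w\<close>, since \<open>w\<close> chooses \<open>X - A\<close>; so it suffices to take \<open>A\<close> minimal in the finite set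
  \<open>v - w\<close>.\<close>

lemma exists_flip_towards:
  assumes v: "v \<in> cube_verts" and w: "w \<in> cube_verts" and "v \<noteq> w"
  obtains A where "A \<in> v - w" "flip A v \<in> cube_verts"
proof -
  note ov = cube_vertsD[OF v] and ow = cube_vertsD[OF w]
  have "v - w \<noteq> {}" using orientation_subset_eq ov ow \<open>v \<noteq> w\<close> by blast
  then obtain A where A: "A \<in> v - w" and min: "\<And>B. B \<in> v - w \<Longrightarrow> B \<subseteq> A \<Longrightarrow> A = B"
    using finite_has_minimal[OF finite_cube_diff[OF v w]] by metis
  have P: "A \<in> proper_halfspaces" and cw: "X - A \<in> w" and cv: "X - A \<notin> v"
    using A orientationD[OF ov] orientation_not_memD[OF ow] by auto
  note AX = proper_halfspaceD[OF P]
  have meet: "B \<inter> (X - A) \<noteq> {}" if B: "B \<in> v - {A}" for B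
  proof
    assume disj: "B \<inter> (X - A) = {}"
    have "B \<subseteq> A" using disj B proper_halfspaceD(1) orientationD(1)[OF ov] by blast
    moreover have "B \<notin> w" using disj cw ow unfolding orientation_def by blast
    ultimately show False using min B by blast
  qed
  have "orientation (flip A v)"
    unfolding orientation_def
  proof (intro conjI ballI)
    show "flip A v \<subseteq> proper_halfspaces"
      using orientationD(1)[OF ov] AX by (auto simp: flip_def)
    fix B assume B: "B \<in> proper_halfspaces"
    then show "(B \<in> flip A v) = (X - B \<notin> flip A v)"
      using A cv AX proper_halfspaceD(2)[OF B] ov unfolding orientation_def flip_def
      by (smt (verit) DiffD1 Diff_iff insert_iff singletonD)
  next
    have ne: "X - A \<noteq> {}" using AX unfolding proper_halfspaces_def by blast
    have vv: "B \<inter> C \<noteq> {}" if "B \<in> v" "C \<in> v" for B C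
      using that ov unfolding orientation_def by blast
    fix B C assume "B \<in> flip A v" "C \<in> flip A v"
    then have "B = X - A \<or> B \<in> v - {A}" "C = X - A \<or> C \<in> v - {A}"
      unfolding flip_def by blast+
    then show "B \<inter> C \<noteq> {}"
      using meet[of B] meet[of C] vv[of B C] ne by (elim disjE) (simp_all add: Int_commute)
  qed
  moreover have "finite (flip A v - v)"
    by (rule finite_subset[of _ "{X - A}"]) (auto simp: flip_def)
  ultimately show ?thesis using cube_vertsI v A that by blast
qed

section \<open>The median graph\<close>

definition cubulation :: "'a set set pair_pre_digraph" where
  "cubulation = \<lparr>pverts = cube_verts,
     parcs = {(v, w). v \<in> cube_verts \<and> w \<in> cube_verts \<and> card (v - w) = 1}\<rparr>"

lemma cubulation_simps [simp]:
  "pverts cubulation = cube_verts"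
  "(v, w) \<in> parcs cubulation \<longleftrightarrow> v \<in> cube_verts \<and> w \<in> cube_verts \<and> card (v - w) = 1"
  unfolding cubulation_def by auto

lemma cubulation_bidirected: "pair_bidirected_digraph cubulation"
  by unfold_locales
    (auto simp: symmetric_def card_cube_diff_commute intro!: symI)

interpretation cube: pair_bidirected_digraph cubulation
  by (rule cubulation_bidirected)

text \<open>Each flip towards \<open>w\<close> removes exactly one halfspace from \<open>v - w\<close>.\<close>

lemma exists_walk:
  assumes "v \<in> cube_verts" "w \<in> cube_verts"
  shows "\<exists>p. cube.awalk v p w \<and> length p = card (v - w)"
  using assms
proof (induction "card (v - w)" arbitrary: v)
  case 0
  then have "v - w = {}" using finite_cube_diff by simp
  then have "v = w" using 0 orientation_subset_eq cube_vertsD by blast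
  then show ?case using 0 by (auto simp: cube.awalk_Nil_iff intro!: exI[of _ "[]"])
next
  case (Suc n)
  then have "v \<noteq> w" by auto
  then obtain A where A: "A \<in> v - w" "flip A v \<in> cube_verts"
    using exists_flip_towards Suc.prems by metis
  have cA: "X - A \<in> w" "X - A \<notin> v"
    using A(1) Suc.prems[THEN cube_vertsD] orientationD orientation_not_memD by auto
  then have "flip A v - w = (v - w) - {A}" "v - flip A v = {A}"
    using A(1) by (auto simp: flip_def)
  then have c: "card (flip A v - w) = n" "card (v - flip A v) = 1"
    using Suc A(1) finite_cube_diff by auto
  then obtain p where "cube.awalk (flip A v) p w" "length p = n"
    using Suc.hyps(1)[of "flip A v"] A(2) Suc.prems(2) by auto
  then have "cube.awalk v ((v, flip A v) # p) w \<and> length ((v, flip A v) # p) = card (v - w)"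
    using Suc A(2) c by (simp add: cube.awalk_Cons_iff)
  then show ?case by blast
qed

lemma card_diff_le_walk_length:
  assumes "cube.awalk v p w"
  shows "card (v - w) \<le> length p"
  using assms
proof (induction p arbitrary: v)
  case Nil
  then show ?case by (simp add: cube.awalk_Nil_iff)
next
  case (Cons e p)
  obtain u where e: "e = (v, u)" using Cons.prems by (cases e) (simp add: cube.awalk_Cons_iff)
  have vu: "v \<in> cube_verts" "u \<in> cube_verts" "card (v - u) = 1" and p: "cube.awalk u p w"
    using Cons.prems by (auto simp: e cube.awalk_Cons_iff)
  have "w \<in> cube_verts" using cube.awalk_last_in_verts[OF p] by simp
  then have "card (v - w) \<le> card ((v - u) \<union> (u - w))"
    using vu finite_cube_diff by (intro card_mono) auto
  also have "\<dots> \<le> card (v - u) + card (u - w)" by (rule card_Un_le)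
  finally show ?case using vu Cons.IH[OF p] by simp
qed

lemma path_dist_cubulation:
  assumes "v \<in> cube_verts" "w \<in> cube_verts"
  shows "path_dist cubulation v w = card (v - w)"
  unfolding path_dist_def
  using exists_walk[OF assms] card_diff_le_walk_length
  by (intro Least_equality) auto

text \<open>The inclusion \<open>v - w \<subseteq> (v - u) \<union> (u - w)\<close> is the triangle inequality. On a geodesic there is no
  room for a halfspace of \<open>v \<inter> w\<close> outside \<open>u\<close>, which would enlarge the right-hand side. Conversely,
  passing to complements turns \<open>v \<inter> w \<subseteq> u\<close> into \<open>u \<subseteq> v \<union> w\<close>, and these two inclusions make the union
  an exact disjoint decomposition.\<close>

lemma geodesic_interval_cubulation:
  assumes v: "v \<in> cube_verts" and w: "w \<in> cube_verts"
  shows "geodesic_interval cubulation v w = {u \<in> cube_verts. v \<inter> w \<subseteq> u}"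
proof (intro set_eqI iffI)
  fix u assume "u \<in> geodesic_interval cubulation v w"
  then obtain p where p: "cube.awalk v p w" "length p = card (v - w)"
    "u \<in> set (pawalk_verts v p)"
    unfolding geodesic_interval_def by (auto simp: path_dist_cubulation[OF v w])
  then obtain q r where qr: "p = q @ r" "cube.awalk v q u" "cube.awalk u r w"
    using cube.awalk_decomp by blast
  have u: "u \<in> cube_verts" using cube.awalk_last_in_verts[OF qr(2)] by simp
  have le: "card (v - u) + card (u - w) \<le> card (v - w)"
    using card_diff_le_walk_length[OF qr(2)] card_diff_le_walk_length[OF qr(3)] p(2) qr(1) by simp
  have "v \<inter> w \<subseteq> u"
  proof
    fix A assume A: "A \<in> v \<inter> w"
    show "A \<in> u"
    proof (rule ccontr)
      assume "A \<notin> u"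
      then have "v - w \<subset> (v - u) \<union> (u - w)" using A by blast
      then have "card (v - w) < card ((v - u) \<union> (u - w))"
        using finite_cube_diff u v w by (intro psubset_card_mono) auto
      also have "\<dots> \<le> card (v - u) + card (u - w)" by (rule card_Un_le)
      finally show False using le by simp
    qed
  qed
  with u show "u \<in> {u \<in> cube_verts. v \<inter> w \<subseteq> u}" by simp
next
  fix u assume "u \<in> {u \<in> cube_verts. v \<inter> w \<subseteq> u}"
  then have u: "u \<in> cube_verts" and sub: "v \<inter> w \<subseteq> u" by auto
  have "u \<subseteq> v \<union> w"
  proof
    fix A assume "A \<in> u"
    then have "A \<in> proper_halfspaces" "X - A \<notin> v \<inter> w"
      using orientationD[OF cube_vertsD[OF u]] sub by auto
    then show "A \<in> v \<union> w" using v w cube_vertsD orientation_not_memD by blast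
  qed
  then have "v - w = (v - u) \<union> (u - w)" "(v - u) \<inter> (u - w) = {}" using sub by auto
  then have c: "card (v - w) = card (v - u) + card (u - w)"
    using finite_cube_diff u v w by (metis card_Un_disjoint)
  obtain q r where q: "cube.awalk v q u" "length q = card (v - u)"
    and r: "cube.awalk u r w" "length r = card (u - w)"
    using exists_walk u v w by meson
  have "u \<in> set (pawalk_verts v (q @ r))"
    using cube.set_awalk_verts_append[OF q(1) r(1)] cube.hd_in_awalk_verts(1)[OF r(1)] by simp
  then show "u \<in> geodesic_interval cubulation v w"
    unfolding geodesic_interval_def
    using cube.awalk_appendI[OF q(1) r(1)] q(2) r(2) c
    by (auto simp: path_dist_cubulation[OF v w] intro!: exI[of _ "q @ r"])
qed

definition majority :: "'a set set \<Rightarrow> 'a set set \<Rightarrow> 'a set set \<Rightarrow> 'a set set" where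
  "majority u v w = (u \<inter> v) \<union> (v \<inter> w) \<union> (w \<inter> u)"

lemma majority_in_cube_verts:
  assumes "u \<in> cube_verts" "v \<in> cube_verts" "w \<in> cube_verts"
  shows "majority u v w \<in> cube_verts"
proof (rule cube_vertsI)
  note o = assms[THEN cube_vertsD]
  show "orientation (majority u v w)"
    unfolding orientation_def
  proof (intro conjI ballI)
    have sub: "u \<subseteq> proper_halfspaces" "v \<subseteq> proper_halfspaces"
      using o unfolding orientation_def by auto
    then show "majority u v w \<subseteq> proper_halfspaces" unfolding majority_def by blast
    show "(A \<in> majority u v w) = (X - A \<notin> majority u v w)" if "A \<in> proper_halfspaces" for A
    proof -
      have "A \<in> u \<longleftrightarrow> X - A \<notin> u" "A \<in> v \<longleftrightarrow> X - A \<notin> v" "A \<in> w \<longleftrightarrow> X - A \<notin> w"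
        using o that unfolding orientation_def by auto
      then show ?thesis unfolding majority_def by blast
    qed
    fix A B assume "A \<in> majority u v w" "B \<in> majority u v w"
    then consider "A \<in> u" "B \<in> u" | "A \<in> v" "B \<in> v" | "A \<in> w" "B \<in> w"
      unfolding majority_def by blast
    then show "A \<inter> B \<noteq> {}" using o unfolding orientation_def by cases auto
  qed
  show "u \<in> cube_verts" by fact
  have "majority u v w - u \<subseteq> v - u" by (auto simp: majority_def)
  then show "finite (majority u v w - u)" using finite_cube_diff assms finite_subset by blast
qed

text \<open>Lying in all three intervals means containing the majority vote, and an orientation contained in
  another one equals it.\<close>

lemma median_cubulation:
  assumes "u \<in> cube_verts" "v \<in> cube_verts" "w \<in> cube_verts"
  shows "geodesic_interval cubulation u v \<inter> geodesic_interval cubulation v w \<inter>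
    geodesic_interval cubulation w u = {majority u v w}"
proof -
  have "m = majority u v w" if "m \<in> cube_verts" "majority u v w \<subseteq> m" for m
    using orientation_subset_eq[OF _ _ that(2)] that(1) cube_vertsD
      majority_in_cube_verts[OF assms] by auto
  moreover have "geodesic_interval cubulation u v \<inter> geodesic_interval cubulation v w \<inter>
    geodesic_interval cubulation w u = {m \<in> cube_verts. majority u v w \<subseteq> m}"
    unfolding geodesic_interval_cubulation[OF assms(1,2)]
      geodesic_interval_cubulation[OF assms(2,3)] geodesic_interval_cubulation[OF assms(3,1)]
      majority_def by blast
  ultimately show ?thesis using majority_in_cube_verts[OF assms] by blast
qed

lemma cube_verts_nonempty: "cube_verts \<noteq> {}"
proof (cases "X = {}")
  case True
  then have "proper_halfspaces = {}"
    using proper_halfspaceD(1) unfolding proper_halfspaces_def by blast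
  then have "{} \<in> cube_verts" by (simp add: cube_verts_def orientation_def)
  then show ?thesis by blast
next
  case False
  then show ?thesis using halfspaces_at_in_cube_verts by blast
qed

lemma cubulation_median_graph: "median_graph cubulation"
proof
  have "v \<rightarrow>\<^sup>*\<^bsub>mk_symmetric cubulation\<^esub> w" if "v \<in> cube_verts" "w \<in> cube_verts" for v w
    using exists_walk[OF that] cube.reachable_awalk cube.reachable_mk_symmetricI by blast
  then show "Digraph_Component.connected cubulation"
    using cube_verts_nonempty
    by (auto simp: Digraph_Component.connected_def strongly_connected_def)
qed (simp add: median_cubulation)

section \<open>The halfspaces of the median graph\<close>

definition cube_halfspace :: "'a set \<Rightarrow> 'a set set set" where
  "cube_halfspace A = {v \<in> cube_verts. A \<in> v}"

lemma cube_halfspace_compl: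
  assumes "A \<in> proper_halfspaces"
  shows "cube_verts - cube_halfspace A = cube_halfspace (X - A)"
proof -
  have "A \<in> v \<longleftrightarrow> X - A \<notin> v" if "v \<in> cube_verts" for v
    using cube_vertsD[OF that] assms unfolding orientation_def by blast
  then show ?thesis unfolding cube_halfspace_def by blast
qed

lemma graph_convex_cube_halfspace: "graph_convex cubulation (cube_halfspace A)"
  unfolding graph_convex_def cube_halfspace_def by (auto simp: geodesic_interval_cubulation)

lemma cube_wall:
  "A \<in> proper_halfspaces \<Longrightarrow> {cube_halfspace A, cube_halfspace (X - A)} \<in> graph_walls cubulation"
  unfolding graph_walls_def mem_Collect_eq
  by (rule exI[of _ "cube_halfspace A"]) (simp add: cube_halfspace_compl graph_convex_cube_halfspace)

text \<open>Among the pairs with one point inside and one outside \<open>K\<close>, a closest one yields an edge from \<open>v\<close> to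
  \<open>flip A v\<close> that leaves \<open>K\<close>. Any \<open>u\<close> containing \<open>A\<close> has \<open>v\<close> on a geodesic from \<open>flip A v\<close>, so it cannot
  lie in the convex complement of \<open>K\<close>; symmetrically, any other \<open>u\<close> has \<open>flip A v\<close> on a geodesic from
  \<open>v\<close> and cannot lie in \<open>K\<close>.\<close>

lemma halfspace_cubulation_cases:
  assumes "graph_convex cubulation K" "graph_convex cubulation (cube_verts - K)"
    and "K \<noteq> {}" "K \<noteq> cube_verts"
  obtains A where "A \<in> proper_halfspaces" "K = cube_halfspace A"
proof -
  have K: "K \<subseteq> cube_verts" using assms(1) by (simp add: graph_convex_def)
  then have "\<exists>p. p \<in> K \<times> (cube_verts - K)" using assms(3,4) by auto
  then obtain p where p: "p \<in> K \<times> (cube_verts - K)"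
    and least: "\<And>q. q \<in> K \<times> (cube_verts - K) \<Longrightarrow> card (fst p - snd p) \<le> card (fst q - snd q)"
    using ex_has_least_nat[of "\<lambda>p. p \<in> K \<times> (cube_verts - K)" _ "\<lambda>p. card (fst p - snd p)"]
    by blast
  obtain v w where vw: "p = (v, w)" by (cases p)
  have v: "v \<in> K" "v \<in> cube_verts" and w: "w \<in> cube_verts" "w \<notin> K" using p vw K by auto
  then obtain A where A: "A \<in> v - w" "flip A v \<in> cube_verts"
    using exists_flip_towards by metis
  have P: "A \<in> proper_halfspaces" using A(1) v(2) cube_vertsD orientationD(1) by blast
  have cA: "X - A \<in> w" "X - A \<notin> v"
    using A(1) cube_vertsD[OF v(2)] cube_vertsD[OF w(1)] orientationD orientation_not_memD
    by auto
  have "flip A v \<notin> K"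
  proof
    assume "flip A v \<in> K"
    then have "card (v - w) \<le> card (flip A v - w)" using least[of "(flip A v, w)"] vw w by simp
    moreover have "flip A v - w \<subset> v - w"
      using A(1) cA by (auto simp: flip_def)
    ultimately show False
      using psubset_card_mono[OF finite_cube_diff[OF v(2) w(1)]] leD by blast
  qed
  then have f: "flip A v \<in> cube_verts - K" using A(2) by blast
  have "u \<in> K \<longleftrightarrow> A \<in> u" if u: "u \<in> cube_verts" for u
  proof
    assume "A \<in> u"
    show "u \<in> K"
    proof (rule ccontr)
      assume "u \<notin> K"
      have "X - A \<notin> u" using \<open>A \<in> u\<close> u cube_vertsD orientationD(2) by blast
      then have "v \<in> geodesic_interval cubulation (flip A v) u"
        using u A(2) v(2) by (auto simp: geodesic_interval_cubulation flip_def)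
      then show False using assms(2) f u \<open>u \<notin> K\<close> v(1) unfolding graph_convex_def by blast
    qed
  next
    assume "u \<in> K"
    show "A \<in> u"
    proof (rule ccontr)
      assume "A \<notin> u"
      then have "flip A v \<in> geodesic_interval cubulation v u"
        using u A(2) v(2) by (auto simp: geodesic_interval_cubulation flip_def)
      then show False using assms(1) f \<open>u \<in> K\<close> v(1) unfolding graph_convex_def by blast
    qed
  qed
  then have "K = cube_halfspace A" using K unfolding cube_halfspace_def by blast
  with P that show ?thesis by blast
qed

text \<open>The walls separating \<open>v\<close> from \<open>w\<close> are those induced by the halfspaces in \<open>v - w\<close>.\<close>

lemma space_with_walls_cubulation: "space_with_walls cube_verts (graph_walls cubulation)"
proof
  show "is_wall cube_verts K" if "K \<in> graph_walls cubulation" for K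
    using that unfolding graph_walls_def is_wall_def graph_convex_def by auto
  have "geodesic_interval cubulation v w \<subseteq> cube_verts" if "v \<in> cube_verts" "w \<in> cube_verts" for v w
    using that by (auto simp: geodesic_interval_cubulation)
  then show "{{}, cube_verts} \<in> graph_walls cubulation"
    unfolding graph_walls_def graph_convex_def by (auto intro!: exI[of _ "{}"])
next
  fix v w assume v: "v \<in> cube_verts" and w: "w \<in> cube_verts" and "v \<noteq> w"
  let ?wall = "\<lambda>A. {cube_halfspace A, cube_halfspace (X - A)}"
  have "K \<in> ?wall ` (v - w)" if K: "K \<in> graph_walls cubulation" "separates K v w" for K
  proof -
    obtain S T where ST: "K = {S, T}" "T = cube_verts - S" "v \<in> S" "w \<in> T"
        "graph_convex cubulation S" "graph_convex cubulation (cube_verts - S)"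
    proof -
      obtain S where S: "K = {S, cube_verts - S}"
        "graph_convex cubulation S" "graph_convex cubulation (cube_verts - S)"
        using K(1) unfolding graph_walls_def by auto
      have SS: "cube_verts - (cube_verts - S) = S"
        using S(2) unfolding graph_convex_def by auto
      show ?thesis
      proof (cases "v \<in> S")
        case True
        then show ?thesis using that[of S "cube_verts - S"] S K(2) w by (auto simp: separates_def)
      next
        case False
        then show ?thesis using that[of "cube_verts - S" S] S SS K(2) v
          by (auto simp: separates_def)
      qed
    qed
    then obtain A where A: "A \<in> proper_halfspaces" "S = cube_halfspace A"
      using halfspace_cubulation_cases[of S] by blast
    then have "A \<in> v - w" "K = ?wall A"
      using ST cube_halfspace_compl w by (auto simp: cube_halfspace_def)
    then show ?thesis by blast
  qed
  then have "{K \<in> graph_walls cubulation. separates K v w} \<subseteq> ?wall ` (v - w)" by blast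
  then show "finite {K \<in> graph_walls cubulation. separates K v w}"
    using finite_cube_diff[OF v w] finite_surj by blast
  obtain A where A: "A \<in> v" "A \<notin> w"
    using \<open>v \<noteq> w\<close> orientation_subset_eq cube_vertsD v w by blast
  then have P: "A \<in> proper_halfspaces" using v cube_vertsD orientationD(1) by blast
  have "v \<in> cube_halfspace A" "w \<in> cube_halfspace (X - A)" "w \<notin> cube_halfspace A"
    using cube_halfspace_compl[OF P] v w A by (auto simp: cube_halfspace_def)
  then have "separates (?wall A) v w" unfolding separates_def by blast
  then show "\<exists>K\<in>graph_walls cubulation. separates K v w" using cube_wall[OF P] by blast
qed

lemma walls_morphism_halfspaces_at: "walls_morphism X W cube_verts (graph_walls cubulation) halfspaces_at"
proof (intro walls_morphism.intro walls_morphism_axioms.intro)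
  show "space_with_walls X W" by unfold_locales
  show "space_with_walls cube_verts (graph_walls cubulation)" by (rule space_with_walls_cubulation)
  show "halfspaces_at x \<in> cube_verts" if "x \<in> X" for x using that by (rule halfspaces_at_in_cube_verts)
  fix K assume "K \<in> halfspaces (graph_walls cubulation)"
  then obtain S where S: "K \<in> {S, cube_verts - S}"
    "graph_convex cubulation S" "graph_convex cubulation (cube_verts - S)"
    unfolding halfspaces_def graph_walls_def by auto
  then have "cube_verts - (cube_verts - S) = S" unfolding graph_convex_def by auto
  then have K: "graph_convex cubulation K" "graph_convex cubulation (cube_verts - K)"
    using S by auto
  consider "K = {}" | "K = cube_verts" | "K \<noteq> {}" "K \<noteq> cube_verts" by blast
  then show "{x \<in> X. halfspaces_at x \<in> K} \<in> halfspaces W"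
  proof cases
    case 1
    then show ?thesis using trivial_halfspaces by simp
  next
    case 2
    then have "{x \<in> X. halfspaces_at x \<in> K} = X" using halfspaces_at_in_cube_verts by blast
    then show ?thesis using trivial_halfspaces by simp
  next
    case 3
    then obtain A where A: "A \<in> proper_halfspaces" "K = cube_halfspace A"
      using halfspace_cubulation_cases K by metis
    then have "{x \<in> X. halfspaces_at x \<in> K} = A"
      using proper_halfspaceD(1)[OF A(1)] halfspaces_at_in_cube_verts
      by (auto simp: cube_halfspace_def halfspaces_at_def)
    then show ?thesis using A(1) by (simp add: proper_halfspaces_def)
  qed
qed

section \<open>The image of X spans\<close>

text \<open>The Helly property for majority votes: at most two halfspaces of \<open>v\<close> are chosen together by a common
  point of \<open>X\<close>. For a larger set, omitting three different members in turn gives three elements of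
  \<open>N\<close>, and each halfspace of the set is chosen by at least two of them.\<close>

lemma majority_closed_helly:
  assumes N: "N \<noteq> {}" "halfspaces_at ` X \<subseteq> N"
    and closed: "\<And>u v w. u \<in> N \<Longrightarrow> v \<in> N \<Longrightarrow> w \<in> N \<Longrightarrow> majority u v w \<in> N"
    and v: "orientation v" and F: "finite F" "F \<subseteq> v"
  shows "\<exists>n\<in>N. F \<subseteq> n"
  using F
proof (induction F rule: finite_psubset_induct)
  case (psubset F)
  have pair: "\<exists>n\<in>N. {A, B} \<subseteq> n" if AB: "A \<in> F" "B \<in> F" for A B
  proof -
    have P: "A \<in> proper_halfspaces" "B \<in> proper_halfspaces" and "A \<inter> B \<noteq> {}"
      using AB psubset.prems v unfolding orientation_def by blast+
    then obtain x where "x \<in> A" "x \<in> B" by blast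
    then have "x \<in> X" "{A, B} \<subseteq> halfspaces_at x"
      using P proper_halfspaceD(1)[OF P(1)] unfolding halfspaces_at_def by auto
    then show ?thesis using N(2) by blast
  qed
  show ?case
  proof (cases "\<exists>A\<in>F. \<exists>B\<in>F. F \<subseteq> {A, B}")
    case True
    then show ?thesis using pair by (meson order_trans)
  next
    case False
    then have big: "\<not> F \<subseteq> {A, B}" if "A \<in> F" "B \<in> F" for A B using that by blast
    show ?thesis
    proof (cases "F = {}")
      case True
      then show ?thesis using N(1) by blast
    next
      case False
      then obtain A where A: "A \<in> F" by blast
      obtain B where B: "B \<in> F" "B \<noteq> A" using big[OF A A] by auto
      obtain C where C: "C \<in> F" "C \<noteq> A" "C \<noteq> B" using big[OF A B(1)] by auto
      have drop: "\<exists>n\<in>N. F - {D} \<subseteq> n" if "D \<in> F" for D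
        using psubset.IH[of "F - {D}"] psubset.prems that by blast
      obtain a b c where abc: "a \<in> N" "b \<in> N" "c \<in> N"
          "F - {A} \<subseteq> a" "F - {B} \<subseteq> b" "F - {C} \<subseteq> c"
        by (metis drop A B(1) C(1))
      then have "F \<subseteq> majority a b c" using B C unfolding majority_def by blast
      then show ?thesis using closed abc by blast
    qed
  qed
qed

text \<open>Fix \<open>n \<in> N\<close>. The Helly property supplies \<open>k \<in> N\<close> that agrees with \<open>v\<close> on the finitely many walls
  where \<open>n\<close> does not; take such a \<open>k\<close> as close to \<open>n\<close> as possible. The walls on which \<open>k\<close> still errs are
  ones where \<open>n\<close> is right, and there are finitely many of them, so some \<open>l \<in> N\<close> is right on all these
  walls at once. The majority vote of \<open>n\<close>, \<open>k\<close> and \<open>l\<close> would then be closer to \<open>n\<close> than \<open>k\<close>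
  unless \<open>k = v\<close>.\<close>

lemma majority_closed_eq_cube_verts:
  assumes N: "N \<noteq> {}" "N \<subseteq> cube_verts" "halfspaces_at ` X \<subseteq> N"
    and closed: "\<And>u v w. u \<in> N \<Longrightarrow> v \<in> N \<Longrightarrow> w \<in> N \<Longrightarrow> majority u v w \<in> N"
  shows "N = cube_verts"
proof (intro equalityI subsetI)
  fix v assume v: "v \<in> cube_verts"
  obtain n where n: "n \<in> N" using N(1) by blast
  then have nC: "n \<in> cube_verts" using N(2) by blast
  have helly: "\<exists>k\<in>N. F \<subseteq> k" if "finite F" "F \<subseteq> v" for F
    using majority_closed_helly[OF N(1,3) closed cube_vertsD[OF v]] that by blast
  have "\<exists>k. k \<in> N \<and> v - n \<subseteq> k" using helly[of "v - n"] finite_cube_diff[OF v nC] by blast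
  then obtain k0 where "k0 \<in> N \<and> v - n \<subseteq> k0" by blast
  then obtain k where k: "k \<in> N" "v - n \<subseteq> k"
    and least: "\<And>m. m \<in> N \<Longrightarrow> v - n \<subseteq> m \<Longrightarrow> card (n - k) \<le> card (n - m)"
    using ex_has_least_nat[of "\<lambda>k. k \<in> N \<and> v - n \<subseteq> k" k0 "\<lambda>k. card (n - k)"]
    by (metis (no_types, lifting))
  have fin: "finite (n - k)" using finite_cube_diff nC N(2) k(1) by blast
  have "finite ((v - n) \<union> (v \<inter> n - k))"
    using fin finite_cube_diff[OF v nC] by (auto intro: rev_finite_subset)
  then obtain l where l: "l \<in> N" "(v - n) \<union> (v \<inter> n - k) \<subseteq> l"
    using helly[of "(v - n) \<union> (v \<inter> n - k)"] by blast
  let ?m = "majority n k l"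
  have "?m \<in> N" "v - n \<subseteq> ?m" using closed n k l by (auto simp: majority_def)
  then have le: "card (n - k) \<le> card (n - ?m)" by (rule least)
  have sub: "n - ?m \<subseteq> n - k" by (auto simp: majority_def)
  have "v \<inter> n \<subseteq> k"
  proof (rule ccontr)
    assume "\<not> v \<inter> n \<subseteq> k"
    then have "n - ?m \<subset> n - k" using sub l(2) unfolding majority_def by blast
    then show False using psubset_card_mono[OF fin] le leD by blast
  qed
  then have "v \<subseteq> k" using k(2) by blast
  then have "v = k" using orientation_subset_eq cube_vertsD v k(1) N(2) by blast
  then show "v \<in> N" using k(1) by simp
qed (use N(2) in blast)

text \<open>Because the distances agree, geodesics of the subgraph are geodesics of the ambient graph. So the
  medians of an isometric median subgraph are the ambient majority votes.\<close>

lemma geodesic_interval_isometric_subgraph: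
  assumes "isometric_subgraph H cubulation" "v \<in> pverts H" "w \<in> pverts H"
  shows "geodesic_interval H v w \<subseteq> geodesic_interval cubulation v w"
proof -
  have "path_dist H v w = path_dist cubulation v w"
    and "\<And>p. pre_digraph.awalk (with_proj H) v p w \<Longrightarrow> cube.awalk v p w"
    using assms cube.subgraph_awalk_imp_awalk[of "with_proj H"]
    unfolding isometric_subgraph_def by auto
  then show ?thesis
    unfolding geodesic_interval_def awalk_verts_with_proj_eq by auto
qed

text \<open>Adjacent vertices have distance one in the subgraph too, so they are joined by a walk consisting of
  a single arc.\<close>

lemma isometric_spanning_subgraph_eq:
  assumes H: "isometric_subgraph H cubulation" and verts: "pverts H = cube_verts"
    and conn: "\<And>v w. v \<in> pverts H \<Longrightarrow> w \<in> pverts H \<Longrightarrow> \<exists>p. pre_digraph.awalk (with_proj H) v p w"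
  shows "H = cubulation"
proof -
  have sub: "parcs H \<subseteq> parcs cubulation" and wf: "wf_digraph (with_proj H)"
    using H unfolding isometric_subgraph_def subgraph_def by auto
  interpret H: pair_wf_digraph H using wf by (simp add: wf_digraph_wp_iff)
  have "(v, w) \<in> parcs H" if vw: "(v, w) \<in> parcs cubulation" for v w
  proof -
    have "path_dist H v w = 1"
      using vw H verts path_dist_cubulation unfolding isometric_subgraph_def by simp
    moreover have "\<exists>p. H.awalk v p w \<and> length p = path_dist H v w"
      unfolding path_dist_def using conn[of v w] vw verts
      by (intro LeastI_ex[of "\<lambda>n. \<exists>p. H.awalk v p w \<and> length p = n"]) auto
    ultimately obtain p where p: "H.awalk v p w" "length p = 1" by auto
    then obtain e where "p = [e]" by (auto simp: length_Suc_conv)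
    then have "e = (v, w)" "e \<in> parcs H"
      using p(1) by (cases e; auto simp: H.awalk_Cons_iff H.awalk_Nil_iff)+
    then show ?thesis by simp
  qed
  then have "parcs H = parcs cubulation" using sub by auto
  then show ?thesis using verts by (auto intro: pair_pre_digraph.equality)
qed

lemma halfspaces_at_spans:
  assumes H: "isometric_subgraph H cubulation" "median_graph H" "halfspaces_at ` X \<subseteq> pverts H"
  shows "H = cubulation"
proof -
  interpret H: median_graph H by fact
  have sub: "pverts H \<subseteq> cube_verts"
    using H(1) unfolding isometric_subgraph_def subgraph_def by auto
  have "pverts H = cube_verts"
  proof (rule majority_closed_eq_cube_verts[OF _ sub H(3)])
    show "pverts H \<noteq> {}"
      using H.connected_graph
      by (auto simp: Digraph_Component.connected_def strongly_connected_def)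
    fix u v w assume uvw: "u \<in> pverts H" "v \<in> pverts H" "w \<in> pverts H"
    obtain m where m: "m \<in> geodesic_interval H u v \<inter> geodesic_interval H v w \<inter>
        geodesic_interval H w u"
      using H.median[OF uvw] by blast
    then have "m \<in> geodesic_interval cubulation u v \<inter> geodesic_interval cubulation v w \<inter>
        geodesic_interval cubulation w u"
      using geodesic_interval_isometric_subgraph[OF H(1)] uvw by blast
    then have "m = majority u v w"
      using median_cubulation[of u v w] uvw sub by auto
    moreover obtain p where "H.awalk u p v" "m \<in> set (pawalk_verts u p)"
      using m unfolding geodesic_interval_def by (auto simp: awalk_verts_with_proj_eq)
    then have "m \<in> pverts H" using H.awalkE' by blast
    ultimately show "majority u v w \<in> pverts H" by simp
  qed
  moreover have "\<exists>p. H.awalk v p w" if "v \<in> pverts H" "w \<in> pverts H" for v w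
    using H.connected_awalkE[OF H.connected_graph] that
      H.mk_symmetric_awalk_imp_awalk[OF H.pair_sym_arcs]
    by (metis with_proj_simps(1))
  ultimately show ?thesis using isometric_spanning_subgraph_eq H(1) by blast
qed

end

theorem theorem4p1:
  fixes X :: "'a set" and W :: "'a set set set"
  assumes "space_with_walls X W"
  shows "\<exists>(C :: 'a set set pair_pre_digraph) \<sigma>.
    median_graph C \<and>
    walls_morphism X W (pverts C) (graph_walls C) \<sigma> \<and>
    inj_on \<sigma> X \<and>
    \<not> (\<exists>H. isometric_subgraph H C \<and> H \<noteq> C \<and> \<sigma> ` X \<subseteq> pverts H \<and> median_graph H)"
proof -
  interpret space_with_walls X W by fact
  show ?thesis
    using cubulation_median_graph walls_morphism_halfspaces_at inj_on_halfspaces_at halfspaces_at_spans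
    by (intro exI[of _ cubulation] exI[of _ halfspaces_at]) auto
qed

end
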